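(* Let $A\in\mathbb{R}^{n\times n}$ be symmetric positive semidefinite with eigenvalues $0\le\lambda_1\le\cdots\le\lambda_n=L$, let $\mathbf{b}\in\mathbb{R}^n$, $\Delta>0$, and $f(\mathbf{x})=\frac12\mathbf{x}^TA\mathbf{x}-\mathbf{b}^T\mathbf{x}$. Let $\mathbf{x}^*$ minimize $f$ over $\{\mathbf{x}:\|\mathbf{x}\|\le\Delta\}$, and suppose the associated KKT multiplier $\mu^*$ is positive, i.e. $\mu^*>0$, $(A+\mu^*I)\mathbf{x}^*=\mathbf{b}$ and $\|\mathbf{x}^*\|=\Delta$. Let $\mathbf{x}_0=\mathbf{0}$ and, for $k\ge1$, let $\mathbf{x}_k$ be the $k$th iterate of the trust-region Lanczos method, i.e. a minimizer of $f$ over $\{\mathbf{x}\in\mathrm{span}\{\mathbf{b},A\mathbf{b},\ldots,A^{k-1}\mathbf{b}\}:\|\mathbf{x}\|\le\Delta\}$. Then for all $k\ge1$, $$f(\mathbf{x}_k)-f(\mathbf{x}^* )\le\frac{3(\lambda_n+\mu^* )\Delta^2}{2(k+1)^2}\le\frac{3\left(L\Delta^2+2(f(\mathbf{x}_0)-f(\mathbf{x}^* ))\right)}{2(k+1)^2}\le\frac{3\left(L\|\mathbf{x}_0-\mathbf{x}^*\|^2+2(f(\mathbf{x}_0)-f(\mathbf{x}^* ))\right)}{2(k+1)^2}.$$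
   Context: All norms are Euclidean. No further non-standard notation is used. *)

theory Defs
  imports "HOL-Analysis.Analysis"
begin

definition pos_semidef :: "real^'n^'n \<Rightarrow> bool" where
  "pos_semidef A \<longleftrightarrow> transpose A = A \<and> (\<forall>x. 0 \<le> x \<bullet> (A *v x))"

text \<open>
  The values \<open>lam 1 \<le> \<dots> \<le> lam n\<close>, with \<open>n = CARD('n)\<close>, are the eigenvalues of \<open>A\<close>
  counted with multiplicity, i.e. the roots of the characteristic polynomial
  \<open>det (t I - A)\<close>. The other values of \<open>lam\<close> are irrelevant.
\<close>
definition ordered_eigenvalues :: "real^'n^'n \<Rightarrow> (nat \<Rightarrow> real) \<Rightarrow> bool" where
  "ordered_eigenvalues A lam \<longleftrightarrow>
     (\<forall>t. det (t *\<^sub>R mat 1 - A) = (\<Prod>i = 1..CARD('n). t - lam i)) \<and>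
     mono_on {1..CARD('n)} lam"

definition quad_obj :: "real^'n^'n \<Rightarrow> real^'n \<Rightarrow> real^'n \<Rightarrow> real" where
  "quad_obj A b x = 1 / 2 * (x \<bullet> (A *v x)) - b \<bullet> x"

text \<open>
  Powers of \<open>A\<close> are written as iterates of \<open>(*v) A\<close>, because \<open>A ^ j\<close> on
  \<open>real^'n^'n\<close> is the entrywise power.
\<close>
definition krylov_space :: "real^'n^'n \<Rightarrow> real^'n \<Rightarrow> nat \<Rightarrow> (real^'n) set" where
  "krylov_space A b k = span ((\<lambda>j. (((*v) A) ^^ j) b) ` {..<k})"

definition tr_lanczos_iterate ::
    "real^'n^'n \<Rightarrow> real^'n \<Rightarrow> real \<Rightarrow> nat \<Rightarrow> real^'n \<Rightarrow> bool" where
  "tr_lanczos_iterate A b \<Delta> k x \<longleftrightarrow>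
     is_arg_min (quad_obj A b) (\<lambda>y. y \<in> krylov_space A b k \<and> norm y \<le> \<Delta>) x"

end

(*
  Write H = A + mu I. The points of the k-th Krylov space are (I - q(H)) x* for the polynomials q of
  degree at most k with q(0) = 1. If 0 <= q <= 1 on the spectrum of H, such a point is feasible, and in an
  eigenbasis of A its gap is half the sum of the c^2 (lambda q^2 + 2 mu q), where c are the
  coordinates of x*; this is at most the sum of the c^2 h q(h) with h = lambda + mu. For q take the
  Fejer kernel sin^2(m theta) / (m^2 sin^2 theta), m = k + 1, which is a polynomial of degree k in
  h / (L + mu) = sin^2 theta. Then h q(h) <= (L + mu) / m^2, so the gap is at most
  (L + mu) Delta^2 / (k + 1)^2.
*)
theory Submission
  imports Defs
begin

section \<open>Orthonormal eigenbases\<close>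

text \<open>First-order condition: the quadratic in \<open>t\<close> vanishes at
  \<open>t = 0\<close>, so 0 is a minimum and the derivative there, \<open>2 * a\<close>, must be
  zero.\<close>

lemma linear_coeff_eq_0:
  fixes a c :: real
  assumes "\<And>t. 0 \<le> 2 * t * a + t\<^sup>2 * c" and "0 \<le> c"
  shows "a = 0"
proof (rule ccontr)
  assume "a \<noteq> 0"
  \<comment> \<open>The vertex would be at \<open>t = - a / c\<close>; the denominator
    \<open>c + 1\<close> also covers \<open>c = 0\<close>.\<close>
  have "2 * (- a / (c + 1)) * a + (- a / (c + 1))\<^sup>2 * c = - (a\<^sup>2 * (c + 2)) / (c + 1)\<^sup>2"
    using \<open>0 \<le> c\<close> by (simp add: divide_simps) (simp add: algebra_simps power2_eq_square)
  moreover have "- (a\<^sup>2 * (c + 2)) / (c + 1)\<^sup>2 < 0"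
    using \<open>a \<noteq> 0\<close> \<open>0 \<le> c\<close> by (simp add: divide_neg_pos mult_pos_pos)
  ultimately show False
    using assms(1)[of "- a / (c + 1)"] by linarith
qed

text \<open>A maximizer \<open>v\<close> of the Rayleigh quotient on the unit sphere of
  \<open>S\<close> is an eigenvector. With \<open>M\<close> the maximum, \<open>g\<close> is
  nonnegative on \<open>S\<close> and zero at \<open>v\<close>, so its first variation at
  \<open>v\<close> vanishes; in the direction of the residual \<open>u = M v - f v\<close> this
  variation is \<open>2 * (u \<bullet> u)\<close>.\<close>

lemma self_adjoint_eigenvector_exists:
  fixes f :: "'a::euclidean_space \<Rightarrow> 'a"
  assumes "linear f" and sa: "\<And>x y. x \<bullet> f y = f x \<bullet> y"
    and S: "subspace S" "f ` S \<subseteq> S" "S \<noteq> {0}"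
  obtains v c where "v \<in> S" "norm v = 1" "f v = c *\<^sub>R v"
proof -
  interpret linear f by fact
  let ?U = "S \<inter> sphere 0 1"
  have "0 \<in> S" using S(1) by (rule subspace_0)
  then obtain w where w: "w \<in> S" "w \<noteq> 0" using S(3) by blast
  have "w /\<^sub>R norm w \<in> ?U"
    using w S(1) by (simp add: subspace_scale)
  then have "?U \<noteq> {}" by blast
  moreover have "compact ?U"
    using closed_subspace[OF S(1)] by (simp add: closed_Int_compact)
  moreover have "continuous_on ?U (\<lambda>x. x \<bullet> f x)"
    by (intro continuous_intros linear_continuous_on linear_conv_bounded_linear[THEN iffD1] \<open>linear f\<close>)
  ultimately obtain v where v: "v \<in> ?U" and max: "\<And>x. x \<in> ?U \<Longrightarrow> x \<bullet> f x \<le> v \<bullet> f v"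
    using continuous_attains_sup[of ?U "\<lambda>x. x \<bullet> f x"] by blast
  define M where "M = v \<bullet> f v"
  define g where "g x = M * (x \<bullet> x) - x \<bullet> f x" for x
  have vv: "v \<bullet> v = 1" using v by (simp add: norm_eq_1)
  have g_nonneg: "0 \<le> g x" if "x \<in> S" for x
  proof (cases "x = 0")
    case True
    then show ?thesis by (simp add: g_def)
  next
    case False
    then have "(x /\<^sub>R norm x) \<bullet> f (x /\<^sub>R norm x) \<le> M"
      unfolding M_def using that S(1) by (intro max) (simp add: subspace_scale)
    then have "x \<bullet> f x / (norm x)\<^sup>2 \<le> M"
      by (simp add: scale power2_eq_square divide_simps)
    then show ?thesis
      using False by (simp add: g_def divide_simps dot_square_norm)
  qed
  define u where "u = M *\<^sub>R v - f v"
  have "u \<in> S"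
    unfolding u_def using v S by (intro subspace_diff subspace_scale) auto
  have uu: "u \<bullet> u = M * (v \<bullet> u) - f v \<bullet> u"
    using inner_diff_left[of "M *\<^sub>R v" "f v" u] by (simp add: u_def)
  have fu: "v \<bullet> f u = f v \<bullet> u" by (rule sa)
  \<comment> \<open>There is no constant term because \<open>g v = M - M = 0\<close>;
    self-adjointness merges the two mixed terms.\<close>
  have "g (v + t *\<^sub>R u) = 2 * t * (M * (v \<bullet> u) - f v \<bullet> u) + t\<^sup>2 * g u" for t
    unfolding g_def add scale inner_add_left inner_add_right inner_scaleR_left inner_scaleR_right
      fu inner_commute[of u v] inner_commute[of u "f v"] vv M_def[symmetric]
    by (simp add: algebra_simps power2_eq_square)
  then have "g (v + t *\<^sub>R u) = 2 * t * (u \<bullet> u) + t\<^sup>2 * g u" for t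
    unfolding uu .
  moreover have "0 \<le> g (v + t *\<^sub>R u)" for t
    using v \<open>u \<in> S\<close> S(1) by (intro g_nonneg subspace_add subspace_scale) auto
  ultimately have "u \<bullet> u = 0"
    using g_nonneg[OF \<open>u \<in> S\<close>] by (metis linear_coeff_eq_0)
  then have "f v = M *\<^sub>R v" by (simp add: u_def)
  then show ?thesis using that v by auto
qed

text \<open>Spectral theorem by induction on the dimension: split off one unit eigenvector
  \<open>v\<close> and continue in its orthogonal complement inside \<open>S\<close>. That
  complement is again invariant, since \<open>f x \<bullet> v = x \<bullet> f v\<close> is a
  multiple of \<open>x \<bullet> v\<close>. The form with an invariant subspace \<open>S\<close> is
  what the induction needs.\<close>

lemma self_adjoint_orthonormal_eigenbasis:
  fixes f :: "'a::euclidean_space \<Rightarrow> 'a"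
  assumes "linear f" and sa: "\<And>x y. x \<bullet> f y = f x \<bullet> y"
    and "subspace S" "f ` S \<subseteq> S"
  shows "\<exists>B \<subseteq> S. pairwise orthogonal B \<and> (\<forall>v\<in>B. norm v = 1 \<and> (\<exists>c. f v = c *\<^sub>R v)) \<and> span B = S"
  using assms(3,4)
proof (induction "dim S" arbitrary: S rule: less_induct)
  case less
  show ?case
  proof (cases "S = {0}")
    case True
    then show ?thesis by (intro exI[of _ "{}"]) auto
  next
    case False
    then obtain v c where v: "v \<in> S" "norm v = 1" "f v = c *\<^sub>R v"
      using self_adjoint_eigenvector_exists[OF assms(1,2) less.prems] by metis
    have vv: "v \<bullet> v = 1" using v by (simp add: norm_eq_1)
    define T where "T = {x \<in> S. x \<bullet> v = 0}"
    have T: "subspace T"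
      using less.prems(1) by (auto simp: T_def subspace_def inner_add_left)
    have "f ` T \<subseteq> T"
      using less.prems(2) by (auto simp: T_def sa[symmetric] v)
    have "v \<notin> T" "T \<subseteq> S" using vv by (auto simp: T_def)
    then have "T \<subset> S" using v(1) by blast
    then have "dim T < dim S"
      using T less.prems(1) by (intro dim_psubset) (simp add: span_eq_iff[THEN iffD2])
    from less.hyps[OF this T \<open>f ` T \<subseteq> T\<close>] obtain B where
      B: "B \<subseteq> T" "pairwise orthogonal B" "\<forall>v\<in>B. norm v = 1 \<and> (\<exists>c. f v = c *\<^sub>R v)" "span B = T"
      by blast
    have "x \<in> span (insert v B)" if "x \<in> S" for x
    proof -
      have "x - (x \<bullet> v) *\<^sub>R v \<in> T"
        using that v vv less.prems(1)
        by (auto simp: T_def inner_diff_left intro!: subspace_diff subspace_scale)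
      then show ?thesis unfolding span_insert B(4) by blast
    qed
    moreover have "span (insert v B) \<subseteq> S"
      using B(1) v less.prems(1) by (intro span_minimal) (auto simp: T_def)
    moreover have "pairwise orthogonal (insert v B)"
      using B(1,2) by (auto simp: pairwise_insert orthogonal_def T_def inner_commute)
    ultimately show ?thesis
      using B v by (intro exI[of _ "insert v B"]) (auto simp: T_def)
  qed
qed

section \<open>Expansions in an orthonormal basis\<close>

lemma finite_orthonormal:
  fixes B :: "'a::euclidean_space set"
  assumes "pairwise orthogonal B" "\<And>v. v \<in> B \<Longrightarrow> norm v = 1"
  shows "finite B"
  using assms pairwise_orthogonal_independent[of B] independent_imp_finite by fastforce

lemma inner_sum_orthonormal:
  fixes B :: "'a::euclidean_space set"
  assumes "pairwise orthogonal B" "\<And>v. v \<in> B \<Longrightarrow> norm v = 1" "v \<in> B"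
  shows "(\<Sum>w\<in>B. a w *\<^sub>R w) \<bullet> v = a v"
proof -
  have "(\<Sum>w\<in>B. a w *\<^sub>R w) \<bullet> v = (\<Sum>w\<in>B. if w = v then a v else 0)"
    unfolding inner_sum_left using assms
    by (intro sum.cong) (auto simp: pairwise_def orthogonal_def dot_square_norm)
  then show ?thesis
    using assms finite_orthonormal[of B] by simp
qed

text \<open>Parseval's identity, by expanding \<open>x\<close> in the basis.\<close>

lemma inner_eq_sum_orthonormal:
  fixes B :: "'a::euclidean_space set"
  assumes "pairwise orthogonal B" "\<And>v. v \<in> B \<Longrightarrow> norm v = 1" "span B = UNIV"
  shows "x \<bullet> y = (\<Sum>v\<in>B. (x \<bullet> v) * (y \<bullet> v))"
proof -
  have "x = (\<Sum>v\<in>B. (x \<bullet> v) *\<^sub>R v)"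
    using assms finite_orthonormal[of B] by (simp add: orthonormal_basis_expand)
  then have "x \<bullet> y = (\<Sum>v\<in>B. (x \<bullet> v) *\<^sub>R v) \<bullet> y" by (rule arg_cong)
  also have "\<dots> = (\<Sum>v\<in>B. (x \<bullet> v) * (y \<bullet> v))"
    unfolding inner_sum_left by (simp add: inner_commute[of y])
  finally show ?thesis .
qed

section \<open>Symmetric matrices and roots of the characteristic polynomial\<close>

lemma symmetric_matrix_inner:
  fixes A :: "real^'n^'n"
  assumes "transpose A = A"
  shows "x \<bullet> (A *v y) = (A *v x) \<bullet> y"
  using assms by (metis dot_lmul_matrix transpose_matrix_vector)

text \<open>An eigenvector makes \<open>c I - A\<close> singular, so \<open>c\<close> is a root of
  the characteristic polynomial and hence one of the \<open>lam i\<close>. This links the eigenbasis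
  to the eigenvalues as encoded by the determinant.\<close>

lemma eigenvalue_le_largest:
  fixes A :: "real^'n^'n"
  assumes "ordered_eigenvalues A lam" and "A *v v = c *\<^sub>R v" "v \<noteq> 0"
  shows "c \<le> lam (CARD('n))"
proof -
  have "(c *\<^sub>R mat 1 - A) *v v = 0"
    using assms(2) by (simp add: matrix_vector_mult_diff_rdistrib scaleR_matrix_vector_assoc[symmetric])
  then have "\<not> invertible (c *\<^sub>R mat 1 - A)"
    using assms(3) by (metis invertible_def matrix_left_invertible_ker)
  then have "(\<Prod>i = 1..CARD('n). c - lam i) = 0"
    using assms(1) by (simp add: ordered_eigenvalues_def invertible_det_nz)
  then obtain i where "i \<in> {1..CARD('n)}" "c = lam i" by auto
  then show ?thesis
    using assms(1) by (auto simp: ordered_eigenvalues_def mono_on_def)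
qed

section \<open>The Fejer kernel\<close>

text \<open>The unnormalized Fejer kernel \<open>sin(m \<theta>)^2 / sin(\<theta>)^2\<close> as a
  polynomial in \<open>t = sin(\<theta>)^2\<close>; in Chebyshev terms,
  \<open>(1 - T_m(1 - 2 t)) / (2 t)\<close>. The recursion is the three-term relation of
  \<open>sin(m \<theta>)^2\<close> divided by \<open>t\<close>.\<close>

fun fejer_poly :: "nat \<Rightarrow> real poly" where
  "fejer_poly 0 = 0"
| "fejer_poly (Suc 0) = 1"
| "fejer_poly (Suc (Suc m)) = [:2:] + [:2, -4:] * fejer_poly (Suc m) - fejer_poly m"

lemma degree_fejer_poly: "degree (fejer_poly m) \<le> m - 1"
proof (induction m rule: fejer_poly.induct)
  case (3 m)
  have "degree ([:2, -4:] * fejer_poly (Suc m)) \<le> 1 + (Suc m - 1)"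
    using 3(1) degree_mult_le[of "[:2, -4:]" "fejer_poly (Suc m)"] by simp
  then show ?case
    using 3(2) by (auto intro!: degree_diff_le degree_add_le)
qed auto

text \<open>The recursion at 0 is \<open>(m + 2)^2 = 2 + 2 (m + 1)^2 - m^2\<close>. The value is the
  constant by which the kernel is later normalized.\<close>

lemma poly_fejer_poly_0: "poly (fejer_poly m) 0 = (real m)\<^sup>2"
  by (induction m rule: fejer_poly.induct) (auto simp: power2_eq_square algebra_simps)

text \<open>The closed form of the kernel, multiplied out so that zeros of
  \<open>sin \<theta>\<close> need no separate treatment.\<close>

lemma poly_fejer_poly_sin:
  "(sin \<theta>)\<^sup>2 * poly (fejer_poly m) ((sin \<theta>)\<^sup>2) = (sin (real m * \<theta>))\<^sup>2"
proof (induction m rule: fejer_poly.induct)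
  case (3 m)
  define a where "a = real (Suc m) * \<theta>"
  have cos2: "(cos x)\<^sup>2 = 1 - (sin x)\<^sup>2" for x :: real
    by (simp add: cos_squared_eq)
  \<comment> \<open>The mixed products of the two addition formulas cancel in the sum of squares;
    replacing the squared cosines then gives the recursion.\<close>
  have "(sin (a + \<theta>))\<^sup>2 + (sin (a - \<theta>))\<^sup>2 = 2 * ((sin a)\<^sup>2 * (cos \<theta>)\<^sup>2 + (cos a)\<^sup>2 * (sin \<theta>)\<^sup>2)"
    by (simp add: sin_add sin_diff power2_eq_square algebra_simps)
  also have "\<dots> = 2 * (sin \<theta>)\<^sup>2 + (2 - 4 * (sin \<theta>)\<^sup>2) * (sin a)\<^sup>2"
    by (simp add: cos2 algebra_simps)
  finally have *: "(sin (a + \<theta>))\<^sup>2 + (sin (a - \<theta>))\<^sup>2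
    = 2 * (sin \<theta>)\<^sup>2 + (2 - 4 * (sin \<theta>)\<^sup>2) * (sin a)\<^sup>2" .
  have "a + \<theta> = real (Suc (Suc m)) * \<theta>" "a - \<theta> = real m * \<theta>"
    by (auto simp: a_def algebra_simps)
  with * 3 show ?case
    unfolding a_def by (simp add: algebra_simps)
qed auto

lemma abs_sin_mult_le: "\<bar>sin (real m * \<theta>)\<bar> \<le> real m * \<bar>sin \<theta>\<bar>"
proof (induction m)
  case (Suc m)
  have "sin (real (Suc m) * \<theta>) = sin (real m * \<theta>) * cos \<theta> + cos (real m * \<theta>) * sin \<theta>"
    by (simp add: algebra_simps sin_add)
  also have "\<bar>\<dots>\<bar> \<le> \<bar>sin (real m * \<theta>)\<bar> * \<bar>cos \<theta>\<bar> + \<bar>cos (real m * \<theta>)\<bar> * \<bar>sin \<theta>\<bar>"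
    by (metis abs_mult abs_triangle_ineq)
  also have "\<dots> \<le> \<bar>sin (real m * \<theta>)\<bar> * 1 + 1 * \<bar>sin \<theta>\<bar>"
    by (intro add_mono mult_mono) auto
  also have "\<dots> \<le> real (Suc m) * \<bar>sin \<theta>\<bar>"
    using Suc.IH by (simp add: algebra_simps)
  finally show ?case .
qed auto

text \<open>With \<open>t = sin(\<theta>)^2\<close>, all three bounds come from
  \<open>t * poly (fejer_poly m) t = sin(m \<theta>)^2\<close>, which lies between 0 and both 1 and
  \<open>m^2 * t\<close>. As \<open>t\<close> is positive, it can be cancelled in the first
  two.\<close>

lemma fejer_poly_bounds:
  assumes "0 < t" "t \<le> 1"
  shows "0 \<le> poly (fejer_poly m) t" "poly (fejer_poly m) t \<le> (real m)\<^sup>2"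
    "t * poly (fejer_poly m) t \<le> 1"
proof -
  define \<theta> where "\<theta> = arcsin (sqrt t)"
  have t: "t = (sin \<theta>)\<^sup>2"
    \<comment> \<open>The transitivity instance supplies \<open>-1 \<le> sqrt t\<close>, needed for
      \<open>sin (arcsin (sqrt t)) = sqrt t\<close>.\<close>
    using assms order_trans[of "-1" 0 "sqrt t"] by (simp add: \<theta>_def)
  have eq: "t * poly (fejer_poly m) t = (sin (real m * \<theta>))\<^sup>2"
    unfolding t by (rule poly_fejer_poly_sin)
  have "0 \<le> t * poly (fejer_poly m) t" unfolding eq by simp
  then show "0 \<le> poly (fejer_poly m) t" using assms by (simp add: zero_le_mult_iff)
  have "(sin (real m * \<theta>))\<^sup>2 \<le> (real m * \<bar>sin \<theta>\<bar>)\<^sup>2"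
    using abs_sin_mult_le[of m \<theta>] by (metis abs_ge_zero power2_abs power_mono)
  then have "t * poly (fejer_poly m) t \<le> t * (real m)\<^sup>2"
    unfolding eq by (simp add: power_mult_distrib t mult.commute)
  then show "poly (fejer_poly m) t \<le> (real m)\<^sup>2" using assms by simp
  show "t * poly (fejer_poly m) t \<le> 1"
    unfolding eq by (simp add: abs_square_le_1)
qed

text \<open>Here \<open>p\<close> serves as an approximate inverse of \<open>e + \<mu>\<close>, with
  the normalized and rescaled Fejer kernel \<open>q\<close> as its residual. Since \<open>q\<close>
  equals 1 at \<open>- \<mu>\<close>, the factor \<open>e + \<mu>\<close> divides
  \<open>1 - q\<close>, and the quotient is \<open>p\<close>.\<close>

lemma fejer_residual_poly:
  fixes L \<mu> :: real
  assumes "0 \<le> L" "0 < \<mu>" "1 \<le> k"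
  obtains p where "degree p < k"
    and "\<And>e. \<lbrakk>0 \<le> e; e \<le> L\<rbrakk> \<Longrightarrow> 0 \<le> 1 - (e + \<mu>) * poly p e"
    and "\<And>e. \<lbrakk>0 \<le> e; e \<le> L\<rbrakk> \<Longrightarrow> 1 - (e + \<mu>) * poly p e \<le> 1"
    and "\<And>e. \<lbrakk>0 \<le> e; e \<le> L\<rbrakk> \<Longrightarrow>
      (e + \<mu>) * (1 - (e + \<mu>) * poly p e) \<le> (L + \<mu>) / (real k + 1)\<^sup>2"
proof -
  define H where "H = L + \<mu>"
  \<comment> \<open>The kernel of index \<open>m\<close> has degree at most
    \<open>m - 1 = k\<close>, and dividing \<open>1 - q\<close> by a linear factor brings the degree
    below \<open>k\<close>.\<close>
  define m where "m = k + 1"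
  have pos: "H > 0" "real m > 0" using assms by (auto simp: H_def m_def)
  \<comment> \<open>The inner affine map sends \<open>e\<close> to \<open>(e + \<mu>) / H\<close>:
    it takes \<open>- \<mu>\<close> to 0 and the interval from 0 to \<open>L\<close> into the range
    where the kernel bounds hold.\<close>
  define q where "q = smult (1 / (real m)\<^sup>2) (fejer_poly m \<circ>\<^sub>p [:\<mu> / H, 1 / H:])"
  have poly_q: "poly q e = poly (fejer_poly m) ((e + \<mu>) / H) / (real m)\<^sup>2" for e
    by (simp add: q_def poly_pcompose add_divide_distrib add.commute)
  have deg_q: "degree q \<le> k"
    using degree_pcompose_le[of "fejer_poly m" "[:\<mu> / H, 1 / H:]"] degree_fejer_poly[of m] pos
    by (auto simp: q_def m_def)
  have "poly (1 - q) (- \<mu>) = 0"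
    using pos by (simp add: poly_q poly_fejer_poly_0)
  then have "[:\<mu>, 1:] dvd 1 - q"
    using poly_eq_0_iff_dvd[of "1 - q" "- \<mu>"] by simp
  then obtain p where p: "1 - q = [:\<mu>, 1:] * p"
    by (rule dvdE)
  have "degree p < k"
  proof (cases "p = 0")
    case False
    then have "Suc (degree p) = degree (1 - q)"
      unfolding p by (subst degree_mult_eq) auto
    also have "\<dots> \<le> k" using deg_q by (intro degree_diff_le) auto
    finally show ?thesis by simp
  qed (use assms in simp)
  moreover have q: "1 - (e + \<mu>) * poly p e = poly q e" for e
  proof -
    have "poly (1 - q) e = (e + \<mu>) * poly p e"
      unfolding p by (simp add: algebra_simps)
    then show ?thesis by simp
  qed
  have t: "0 < (e + \<mu>) / H" "(e + \<mu>) / H \<le> 1" if "0 \<le> e" "e \<le> L" for e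
    using that assms pos by (auto simp: H_def)
  have "(e + \<mu>) * poly q e \<le> H / (real m)\<^sup>2" if "0 \<le> e" "e \<le> L" for e
  proof -
    have "(e + \<mu>) * poly q e = H / (real m)\<^sup>2 * ((e + \<mu>) / H * poly (fejer_poly m) ((e + \<mu>) / H))"
      using pos by (simp add: poly_q)
    also have "\<dots> \<le> H / (real m)\<^sup>2 * 1"
      using pos fejer_poly_bounds(3)[OF t[OF that]] by (intro mult_left_mono) auto
    finally show ?thesis by simp
  qed
  moreover have "0 \<le> poly q e" "poly q e \<le> 1" if "0 \<le> e" "e \<le> L" for e
    using fejer_poly_bounds(1,2)[OF t[OF that], of m] pos by (auto simp: poly_q divide_simps)
  ultimately show ?thesis
    using that[of p] unfolding q by (simp add: H_def m_def add.commute)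
qed

section \<open>The comparison point in the Krylov space\<close>

text \<open>The sum is \<open>p(A) b\<close> written in the eigenbasis, so it is a combination of
  the vectors \<open>A^j b\<close> with \<open>j \<le> degree p < k\<close>.\<close>

lemma eigenbasis_poly_in_krylov_space:
  fixes A :: "real^'n^'n"
  assumes B: "pairwise orthogonal B" "\<And>v. v \<in> B \<Longrightarrow> norm v = 1" "span B = UNIV"
    and ev: "\<And>v. v \<in> B \<Longrightarrow> A *v v = e v *\<^sub>R v"
    and "degree p < k"
  shows "(\<Sum>v\<in>B. (poly p (e v) * (b \<bullet> v)) *\<^sub>R v) \<in> krylov_space A b k"
proof -
  have fin: "finite B" using B by (intro finite_orthonormal) auto
  have pow: "((*v) A ^^ j) b = (\<Sum>v\<in>B. (e v ^ j * (b \<bullet> v)) *\<^sub>R v)" for j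
  proof (induction j)
    case 0
    show ?case using B fin by (simp add: orthonormal_basis_expand)
  next
    case (Suc j)
    have "((*v) A ^^ Suc j) b = (\<Sum>v\<in>B. (e v ^ j * (b \<bullet> v)) *\<^sub>R (A *v v))"
      using Suc.IH by (simp add: vec.sum matrix_vector_mult_scaleR)
    also have "\<dots> = (\<Sum>v\<in>B. (e v ^ Suc j * (b \<bullet> v)) *\<^sub>R v)"
      by (intro sum.cong) (auto simp: ev mult_ac)
    finally show ?case .
  qed
  have "(\<Sum>v\<in>B. (poly p (e v) * (b \<bullet> v)) *\<^sub>R v)
    = (\<Sum>v\<in>B. \<Sum>j\<le>degree p. coeff p j *\<^sub>R (e v ^ j * (b \<bullet> v)) *\<^sub>R v)"
    by (simp add: poly_altdef sum_distrib_right scaleR_sum_left mult.assoc)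
  also have "\<dots> = (\<Sum>j\<le>degree p. coeff p j *\<^sub>R ((*v) A ^^ j) b)"
    unfolding pow by (subst sum.swap) (simp add: scaleR_sum_right)
  also have "\<dots> \<in> krylov_space A b k"
    unfolding krylov_space_def using \<open>degree p < k\<close>
    by (intro span_sum span_scale span_base) auto
  finally show ?thesis .
qed

text \<open>The eigenbasis diagonalizes \<open>A\<close>, so the objective separates into one scalar
  quadratic per coordinate.\<close>

lemma quad_obj_eigenbasis:
  fixes A :: "real^'n^'n"
  assumes sym: "transpose A = A"
    and B: "pairwise orthogonal B" "\<And>v. v \<in> B \<Longrightarrow> norm v = 1" "span B = UNIV"
    and ev: "\<And>v. v \<in> B \<Longrightarrow> A *v v = e v *\<^sub>R v"
  shows "quad_obj A b x = (\<Sum>v\<in>B. e v * (x \<bullet> v)\<^sup>2 / 2 - (b \<bullet> v) * (x \<bullet> v))"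
proof -
  have Av: "(A *v x) \<bullet> v = e v * (x \<bullet> v)" if "v \<in> B" for v
    using symmetric_matrix_inner[OF sym, of x v] ev[OF that] by simp
  have parseval: "x \<bullet> y = (\<Sum>v\<in>B. (x \<bullet> v) * (y \<bullet> v))" for x y
    using B by (rule inner_eq_sum_orthonormal)
  have "x \<bullet> (A *v x) = (\<Sum>v\<in>B. e v * (x \<bullet> v)\<^sup>2)"
    unfolding parseval[of x "A *v x"] by (intro sum.cong) (auto simp: Av power2_eq_square)
  then show ?thesis
    by (simp add: quad_obj_def parseval[of b x] sum_subtractf sum_divide_distrib)
qed

text \<open>The witness is \<open>p(A) b\<close> for the approximate inverse \<open>p\<close> of
  \<open>e + \<mu>\<close>; applied to \<open>b = (A + \<mu> I) xs\<close> it multiplies each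
  coordinate of \<open>xs\<close> by \<open>1 - q v\<close>, a factor between 0 and 1.\<close>

lemma krylov_point_gap:
  fixes A :: "real^'n^'n" and b xs :: "real^'n"
  assumes A: "pos_semidef A" and lam: "ordered_eigenvalues A lam" "lam (CARD('n)) = L"
    and "0 < \<mu>" and b: "(A + \<mu> *\<^sub>R mat 1) *v xs = b" and k: "1 \<le> k"
  obtains y where "y \<in> krylov_space A b k" "norm y \<le> norm xs"
    "quad_obj A b y - quad_obj A b xs \<le> (L + \<mu>) * (norm xs)\<^sup>2 / (real k + 1)\<^sup>2"
proof -
  have sym: "transpose A = A" and psd: "\<And>x. 0 \<le> x \<bullet> (A *v x)"
    using A by (auto simp: pos_semidef_def)
  obtain B where B: "pairwise orthogonal B" "\<And>v. v \<in> B \<Longrightarrow> norm v = 1" "span B = UNIV"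
    and "\<forall>v\<in>B. \<exists>c. A *v v = c *\<^sub>R v"
    using self_adjoint_orthonormal_eigenbasis[of "(*v) A" UNIV] symmetric_matrix_inner[OF sym]
    by auto
  then obtain e where ev: "\<And>v. v \<in> B \<Longrightarrow> A *v v = e v *\<^sub>R v" by metis
  have e: "0 \<le> e v" "e v \<le> L" if "v \<in> B" for v
  proof -
    show "0 \<le> e v"
      using psd[of v] B(2)[OF that] by (simp add: ev[OF that] dot_square_norm)
    have "v \<noteq> 0" using B(2)[OF that] by auto
    then show "e v \<le> L"
      using eigenvalue_le_largest[OF lam(1) ev[OF that]] lam(2) by simp
  qed
  \<comment> \<open>Some basis vector is needed to conclude \<open>0 \<le> e v \<le> L\<close>, and
    so \<open>0 \<le> L\<close>.\<close>
  have "B \<noteq> {}"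
  proof
    assume "B = {}"
    then have "(UNIV :: (real^'n) set) = {0}" using B(3) by simp
    then show False by (metis UNIV_I singletonD zero_neq_one)
  qed
  then have "0 \<le> L" using e by force
  then obtain p where deg: "degree p < k"
    and p: "\<And>e. \<lbrakk>0 \<le> e; e \<le> L\<rbrakk> \<Longrightarrow> 0 \<le> 1 - (e + \<mu>) * poly p e"
      "\<And>e. \<lbrakk>0 \<le> e; e \<le> L\<rbrakk> \<Longrightarrow> 1 - (e + \<mu>) * poly p e \<le> 1"
      "\<And>e. \<lbrakk>0 \<le> e; e \<le> L\<rbrakk> \<Longrightarrow> (e + \<mu>) * (1 - (e + \<mu>) * poly p e) \<le> (L + \<mu>) / (real k + 1)\<^sup>2"
    using fejer_residual_poly \<open>0 < \<mu>\<close> k by metis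
  define q where "q v = 1 - (e v + \<mu>) * poly p (e v)" for v
  define y where "y = (\<Sum>v\<in>B. (poly p (e v) * (b \<bullet> v)) *\<^sub>R v)"
  have bv: "b \<bullet> v = (e v + \<mu>) * (xs \<bullet> v)" if "v \<in> B" for v
  proof -
    have "b = A *v xs + \<mu> *\<^sub>R xs"
      by (simp add: b[symmetric] matrix_vector_mult_add_rdistrib scaleR_matrix_vector_assoc[symmetric])
    then show ?thesis
      using symmetric_matrix_inner[OF sym, of xs v] ev[OF that]
      by (simp add: inner_add_left algebra_simps)
  qed
  have yv: "y \<bullet> v = (1 - q v) * (xs \<bullet> v)" if "v \<in> B" for v
    using inner_sum_orthonormal[OF B(1,2) that, of "\<lambda>v. poly p (e v) * (b \<bullet> v)"] bv[OF that]
    by (simp add: y_def q_def)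
  have obj: "quad_obj A b x = (\<Sum>v\<in>B. e v * (x \<bullet> v)\<^sup>2 / 2 - (b \<bullet> v) * (x \<bullet> v))" for x
    using sym B ev by (rule quad_obj_eigenbasis)
  have norm2: "(norm x)\<^sup>2 = (\<Sum>v\<in>B. (x \<bullet> v)\<^sup>2)" for x
    using inner_eq_sum_orthonormal[OF B, of x x] by (simp add: dot_square_norm power2_eq_square)
  have q: "0 \<le> q v" "q v \<le> 1" "(e v + \<mu>) * q v \<le> (L + \<mu>) / (real k + 1)\<^sup>2" if "v \<in> B" for v
    using p e[OF that] by (auto simp: q_def)
  show ?thesis
  proof
    show "y \<in> krylov_space A b k"
      unfolding y_def by (intro eigenbasis_poly_in_krylov_space B ev deg)
    have "(norm y)\<^sup>2 \<le> (norm xs)\<^sup>2"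
      unfolding norm2
    proof (intro sum_mono)
      fix v assume v: "v \<in> B"
      have "(1 - q v)\<^sup>2 \<le> 1" using q[OF v] by (simp add: abs_square_le_1)
      then show "(y \<bullet> v)\<^sup>2 \<le> (xs \<bullet> v)\<^sup>2"
        by (simp add: yv[OF v] power_mult_distrib mult_left_le_one_le)
    qed
    then show "norm y \<le> norm xs" by simp
    \<comment> \<open>Per coordinate, the terms linear in \<open>q v\<close> are
      \<open>- e v * q v\<close> from the quadratic part and \<open>(e v + \<mu>) * q v\<close> from
      the linear part; only \<open>\<mu> * q v\<close> survives.\<close>
    have "quad_obj A b y - quad_obj A b xs
      = (\<Sum>v\<in>B. (e v * (q v)\<^sup>2 / 2 + \<mu> * q v) * (xs \<bullet> v)\<^sup>2)"
      unfolding obj sum_subtractf[symmetric]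
      by (intro sum.cong) (auto simp: yv bv power2_eq_square algebra_simps add_divide_distrib diff_divide_distrib)
    also have "\<dots> \<le> (\<Sum>v\<in>B. (L + \<mu>) / (real k + 1)\<^sup>2 * (xs \<bullet> v)\<^sup>2)"
    proof (intro sum_mono mult_right_mono)
      fix v assume v: "v \<in> B"
      \<comment> \<open>The factor 1/2 is given up here, so that the kernel bound on
        \<open>(e v + \<mu>) * q v\<close> covers both terms at once.\<close>
      have "(q v)\<^sup>2 \<le> q v" using q[OF v] by (simp add: power2_eq_square mult_left_le)
      then have "e v * (q v)\<^sup>2 \<le> e v * q v" using e[OF v] by (intro mult_left_mono)
      moreover have "0 \<le> e v * q v" using e[OF v] q[OF v] by simp
      ultimately have "e v * (q v)\<^sup>2 / 2 + \<mu> * q v \<le> (e v + \<mu>) * q v"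
        by (simp add: distrib_right)
      then show "e v * (q v)\<^sup>2 / 2 + \<mu> * q v \<le> (L + \<mu>) / (real k + 1)\<^sup>2"
        using q(3)[OF v] by linarith
    qed simp
    also have "\<dots> = (L + \<mu>) * (norm xs)\<^sup>2 / (real k + 1)\<^sup>2"
      by (simp add: norm2 sum_distrib_left sum_divide_distrib)
    finally show "quad_obj A b y - quad_obj A b xs \<le> (L + \<mu>) * (norm xs)\<^sup>2 / (real k + 1)\<^sup>2" .
  qed
qed

section \<open>The chain of three inequalities for the iterates\<close>

theorem mainTheorem13:
  fixes A :: "real^'n^'n" and b xs :: "real^'n" and x :: "nat \<Rightarrow> real^'n"
    and lam :: "nat \<Rightarrow> real" and L \<Delta> \<mu> :: real and f :: "real^'n \<Rightarrow> real"
  assumes A: "pos_semidef A"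
    and eigenvalues: "ordered_eigenvalues A lam" "0 \<le> lam 1" "lam (CARD('n)) = L"
    and Delta: "\<Delta> > 0"
    and f: "f = quad_obj A b"
    and minimizer: "is_arg_min f (\<lambda>y. norm y \<le> \<Delta>) xs"
    and kkt: "\<mu> > 0" "(A + \<mu> *\<^sub>R mat 1) *v xs = b" "norm xs = \<Delta>"
    and x_0: "x 0 = 0"
    and x_k: "\<And>k. k \<ge> 1 \<Longrightarrow> tr_lanczos_iterate A b \<Delta> k (x k)"
  shows "\<forall>k\<ge>1.
      f (x k) - f xs \<le> 3 * (lam (CARD('n)) + \<mu>) * \<Delta>\<^sup>2 / (2 * (real k + 1)\<^sup>2) \<and>
      3 * (lam (CARD('n)) + \<mu>) * \<Delta>\<^sup>2 / (2 * (real k + 1)\<^sup>2)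
        \<le> 3 * (L * \<Delta>\<^sup>2 + 2 * (f (x 0) - f xs)) / (2 * (real k + 1)\<^sup>2) \<and>
      3 * (L * \<Delta>\<^sup>2 + 2 * (f (x 0) - f xs)) / (2 * (real k + 1)\<^sup>2)
        \<le> 3 * (L * (norm (x 0 - xs))\<^sup>2 + 2 * (f (x 0) - f xs)) / (2 * (real k + 1)\<^sup>2)"
proof (intro allI impI conjI)
  fix k :: nat assume k: "1 \<le> k"
  obtain y where y: "y \<in> krylov_space A b k" "norm y \<le> \<Delta>"
    and gap: "f y - f xs \<le> (L + \<mu>) * \<Delta>\<^sup>2 / (real k + 1)\<^sup>2"
    using krylov_point_gap[OF A eigenvalues(1,3) kkt(1,2) k] unfolding f kkt(3) by metis
  have "f (x k) \<le> f y"
    using x_k[OF k] y by (auto simp: tr_lanczos_iterate_def is_arg_min_linorder f)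
  \<comment> \<open>The comparison point gives the constant 1; nonnegativity of the bound allows
    passing to the larger constant 3/2.\<close>
  moreover have "0 \<le> (L + \<mu>) * \<Delta>\<^sup>2 / (real k + 1)\<^sup>2"
  proof -
    have "lam 1 \<le> lam (CARD('n))"
      using eigenvalues(1) by (auto simp: ordered_eigenvalues_def mono_on_def Suc_le_eq)
    then show ?thesis using eigenvalues kkt(1) by simp
  qed
  moreover have "3 * (L + \<mu>) * \<Delta>\<^sup>2 / (2 * (real k + 1)\<^sup>2) = 3 / 2 * ((L + \<mu>) * \<Delta>\<^sup>2 / (real k + 1)\<^sup>2)"
    by simp
  ultimately show "f (x k) - f xs \<le> 3 * (lam (CARD('n)) + \<mu>) * \<Delta>\<^sup>2 / (2 * (real k + 1)\<^sup>2)"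
    using gap unfolding eigenvalues(3) by linarith
next
  fix k :: nat
  have "b = A *v xs + \<mu> *\<^sub>R xs"
    by (simp add: kkt(2)[symmetric] matrix_vector_mult_add_rdistrib scaleR_matrix_vector_assoc[symmetric])
  then have "b \<bullet> xs = xs \<bullet> (A *v xs) + \<mu> * \<Delta>\<^sup>2"
    by (metis inner_add_left inner_commute inner_scaleR_left dot_square_norm kkt(3))
  \<comment> \<open>Since \<open>f 0 = 0\<close>, the left side is
    \<open>2 * (b \<bullet> xs) - xs \<bullet> (A *v xs)\<close>. The second inequality then follows
    by dropping the nonnegative \<open>xs \<bullet> (A *v xs)\<close> and one of the two copies of
    \<open>\<mu> * \<Delta>\<^sup>2\<close>.\<close>
  then have "2 * (f (x 0) - f xs) = xs \<bullet> (A *v xs) + 2 * \<mu> * \<Delta>\<^sup>2"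
    by (simp add: f x_0 quad_obj_def)
  moreover have "0 \<le> xs \<bullet> (A *v xs)" using A by (simp add: pos_semidef_def)
  moreover have "0 \<le> \<mu> * \<Delta>\<^sup>2" using kkt(1) by simp
  ultimately have "(L + \<mu>) * \<Delta>\<^sup>2 \<le> L * \<Delta>\<^sup>2 + 2 * (f (x 0) - f xs)"
    by (simp add: distrib_right)
  then show "3 * (lam (CARD('n)) + \<mu>) * \<Delta>\<^sup>2 / (2 * (real k + 1)\<^sup>2)
      \<le> 3 * (L * \<Delta>\<^sup>2 + 2 * (f (x 0) - f xs)) / (2 * (real k + 1)\<^sup>2)"
    unfolding eigenvalues(3) mult.assoc by (intro divide_right_mono mult_left_mono) auto
  \<comment> \<open>Both sides agree, because \<open>x 0 = 0\<close> and
    \<open>norm xs = \<Delta>\<close>.\<close>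
  show "3 * (L * \<Delta>\<^sup>2 + 2 * (f (x 0) - f xs)) / (2 * (real k + 1)\<^sup>2)
      \<le> 3 * (L * (norm (x 0 - xs))\<^sup>2 + 2 * (f (x 0) - f xs)) / (2 * (real k + 1)\<^sup>2)"
    by (simp add: x_0 kkt(3))
qed

end
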